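(* For any graph $G$ of order $n\ge 2$ and any graph $H$ of order $n'\ge 2$, $$\gamma_{\rm sp}(G\circ H)\le \min\{\,n(n'-1)+\gamma_{\rm sp}(G),\ n'(n-1)+\gamma_{\rm sp}(H)\,\}.$$
   Context: All graphs are finite, simple and undirected; the order of a graph is its number of vertices. For a vertex $v$ of $G$, $N(v)$ is the set of vertices adjacent to $v$, and for $D\subseteq V(G)$, $\overline{D}=V(G)\setminus D$. A set $D\subseteq V(G)$ is a super dominating set of $G$ if for every $u\in\overline{D}$ there exists $v\in D$ such that $N(v)\cap\overline{D}=\{u\}$. The super domination number $\gamma_{\rm sp}(G)$ is the minimum cardinality of a super dominating set of $G$. The lexicographic product $G\circ H$ has vertex set $V(G)\times V(H)$, and $(g,h)$ is adjacent to $(g',h')$ if and only if $gg'\in E(G)$, or $g=g'$ and $hh'\in E(H)$. *)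

theory Defs
  imports "Graph_Theory.Pair_Digraph"
begin

text \<open>A finite simple undirected graph is a \<^term>\<open>pair_graph\<close>: a finite loop-free pair
  digraph whose arc relation is symmetric, each edge being represented by its two orientations.\<close>

definition neighbourhood :: "'a pair_pre_digraph \<Rightarrow> 'a \<Rightarrow> 'a set" where
  "neighbourhood G v = {w. (v, w) \<in> parcs G}"

definition super_dominating :: "'a pair_pre_digraph \<Rightarrow> 'a set \<Rightarrow> bool" where
  "super_dominating G D \<longleftrightarrow>
     D \<subseteq> pverts G \<and>
     (\<forall>u \<in> pverts G - D. \<exists>v \<in> D. neighbourhood G v \<inter> (pverts G - D) = {u})"

definition super_domination_number :: "'a pair_pre_digraph \<Rightarrow> nat" where
  "super_domination_number G = Min (card ` {D. super_dominating G D})"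

definition lex_product ::
    "'a pair_pre_digraph \<Rightarrow> 'b pair_pre_digraph \<Rightarrow> ('a \<times> 'b) pair_pre_digraph" where
  "lex_product G H =
     \<lparr> pverts = pverts G \<times> pverts H,
       parcs = {((g, h), (g', h')) | g h g' h'.
         g \<in> pverts G \<and> h \<in> pverts H \<and> g' \<in> pverts G \<and> h' \<in> pverts H \<and>
         ((g, g') \<in> parcs G \<or> g = g' \<and> (h, h') \<in> parcs H)} \<rparr>"

text \<open>The minimum defining \<^term>\<open>super_domination_number\<close> is taken over a finite nonempty set.\<close>

lemma super_dominating_pverts: "super_dominating G (pverts G)"
  by (simp add: super_dominating_def)

lemma finite_super_dominating:
  assumes "pair_graph G"
  shows "finite {D. super_dominating G D}"
proof -
  interpret pair_graph G by (rule assms)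
  show ?thesis
    by (rule finite_subset[of _ "Pow (pverts G)"])
      (auto simp: super_dominating_def pair_finite_verts)
qed

lemma pair_graph_lex_product:
  assumes "pair_graph G" and "pair_graph H"
  shows "pair_graph (lex_product G H)"
proof -
  interpret G: pair_graph G by (rule assms)
  interpret H: pair_graph H by (rule assms)
  have sym_G: "(v, u) \<in> parcs G" if "(u, v) \<in> parcs G" for u v
    using that G.pair_sym_arcs by (auto simp: symmetric_def dest: symD)
  have sym_H: "(v, u) \<in> parcs H" if "(u, v) \<in> parcs H" for u v
    using that H.pair_sym_arcs by (auto simp: symmetric_def dest: symD)
  have arcs: "parcs (lex_product G H) \<subseteq> (pverts G \<times> pverts H) \<times> (pverts G \<times> pverts H)"
    by (auto simp: lex_product_def)
  show ?thesis
  proof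
    show "finite (pverts (lex_product G H))"
      by (simp add: lex_product_def G.pair_finite_verts H.pair_finite_verts)
    show "finite (parcs (lex_product G H))"
      using arcs by (rule finite_subset) (simp add: G.pair_finite_verts H.pair_finite_verts)
    show "symmetric (lex_product G H)"
      by (auto simp: symmetric_def lex_product_def intro!: symI dest: sym_G sym_H)
    show "fst e \<noteq> snd e" if "e \<in> parcs (lex_product G H)" for e
      using that G.pair_no_loops H.pair_no_loops by (fastforce simp: lex_product_def)
  qed (auto simp: lex_product_def)
qed

end

theory Submission
  imports Defs
begin

text \<open>
  Both bounds are instances of one principle: if a graph \<open>K\<close> of order \<open>k\<close> embeds as an induced
  subgraph in a graph \<open>L\<close> of order \<open>l\<close>, then
  \<open>\<gamma>\<^sub>s\<^sub>p(L) \<le> (l - k) + \<gamma>\<^sub>s\<^sub>p(K)\<close>. The super domination condition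
  depends only on the vertices left out of \<open>D\<close> and on their neighbours in \<open>D\<close>; so leaving out of
  \<open>L\<close> exactly the copies of the vertices that a minimum set of \<open>K\<close> leaves out gives a super
  dominating set of \<open>L\<close>, the copy of each old witness serving again
  (\<open>super_dominating_extend\<close>).

  The product \<open>G \<circ> H\<close>, of order \<open>n n'\<close>, contains every layer \<open>V(G) \<times> {h}\<close> as an
  induced copy of \<open>G\<close> and every layer \<open>{g} \<times> V(H)\<close> as an induced copy of \<open>H\<close>, since neither factor
  has loops. The two layers give the two terms of the minimum.
\<close>

lemma super_domination_number_le:
  assumes "pair_graph G" and "super_dominating G D"
  shows "super_domination_number G \<le> card D"
  using assms finite_super_dominating[OF assms(1)]
  by (auto simp: super_domination_number_def)

lemma super_domination_number_attained:
  assumes "pair_graph G"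
  obtains D where "super_dominating G D" and "card D = super_domination_number G"
proof -
  have "super_domination_number G \<in> card ` {D. super_dominating G D}"
    unfolding super_domination_number_def
    using finite_super_dominating[OF assms] super_dominating_pverts
    by (intro Min_in) blast+
  then show thesis using that by force
qed

text \<open>The witness for the copy \<open>f u\<close> is the copy \<open>f v\<close> of a witness \<open>v\<close> for \<open>u\<close>. It may gain
  neighbours outside the copy of \<open>K\<close>, but all of those lie in the extended set, so among the
  vertices left out it still sees only \<open>f u\<close>.\<close>

lemma super_dominating_extend:
  assumes D: "super_dominating K D"
    and inj: "inj_on f (pverts K)"
    and img: "f ` pverts K \<subseteq> pverts L"
    and induced: "\<And>x y. \<lbrakk>x \<in> pverts K; y \<in> pverts K\<rbrakk>
      \<Longrightarrow> (f x, f y) \<in> parcs L \<longleftrightarrow> (x, y) \<in> parcs K"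
  shows "super_dominating L (pverts L - f ` (pverts K - D))"
proof -
  let ?S = "pverts K - D"
  have DK: "D \<subseteq> pverts K" using D by (simp add: super_dominating_def)
  have left_out: "pverts L - (pverts L - f ` ?S) = f ` ?S" using img by blast
  have "\<exists>w \<in> pverts L - f ` ?S. neighbourhood L w \<inter> f ` ?S = {f u}" if "u \<in> ?S" for u
  proof -
    from D that obtain v where v: "v \<in> D" "neighbourhood K v \<inter> ?S = {u}"
      unfolding super_dominating_def by blast
    have "f v \<in> pverts L - f ` ?S"
      using v(1) DK img inj by (auto dest: inj_onD)
    moreover have "neighbourhood L (f v) \<inter> f ` ?S = f ` (neighbourhood K v \<inter> ?S)"
      using induced v(1) DK by (auto simp: neighbourhood_def)
    ultimately show ?thesis using v(2) by auto
  qed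
  then show ?thesis unfolding super_dominating_def left_out by blast
qed

text \<open>The bound \<open>\<gamma>\<^sub>s\<^sub>p(L) \<le> (l - k) + \<gamma>\<^sub>s\<^sub>p(K)\<close>, with the order of
  \<open>K\<close> moved to the left to avoid truncated subtraction.\<close>

lemma super_domination_number_induced_subgraph:
  assumes K: "pair_graph K" and L: "pair_graph L"
    and inj: "inj_on f (pverts K)"
    and img: "f ` pverts K \<subseteq> pverts L"
    and induced: "\<And>x y. \<lbrakk>x \<in> pverts K; y \<in> pverts K\<rbrakk>
      \<Longrightarrow> (f x, f y) \<in> parcs L \<longleftrightarrow> (x, y) \<in> parcs K"
  shows "super_domination_number L + card (pverts K)
    \<le> card (pverts L) + super_domination_number K"
proof -
  interpret K: pair_graph K by (rule K)
  interpret L: pair_graph L by (rule L)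
  obtain D where D: "super_dominating K D" "card D = super_domination_number K"
    using super_domination_number_attained[OF K] .
  let ?S = "pverts K - D"
  have DK: "D \<subseteq> pverts K" using D(1) by (simp add: super_dominating_def)
  then have finD: "finite D" using K.pair_finite_verts finite_subset by blast
  have "super_domination_number L \<le> card (pverts L - f ` ?S)"
    using super_domination_number_le[OF L super_dominating_extend[OF D(1) inj img induced]] .
  moreover have "card (pverts L - f ` ?S) + card (f ` ?S) = card (pverts L)"
  proof -
    have sub: "f ` ?S \<subseteq> pverts L" using img by blast
    have "finite (f ` ?S)" using K.pair_finite_verts by simp
    then show ?thesis
      using card_Diff_subset[OF _ sub] card_mono[OF L.pair_finite_verts sub] by simp
  qed
  moreover have "card (f ` ?S) = card ?S"
    using inj by (intro card_image inj_on_subset[OF inj]) auto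
  moreover have "card ?S + card D = card (pverts K)"
    using card_Diff_subset[OF finD DK] card_mono[OF K.pair_finite_verts DK] by simp
  ultimately show ?thesis using D(2) by linarith
qed

lemma card_pverts_lex_product:
  "card (pverts (lex_product G H)) = card (pverts G) * card (pverts H)"
  by (simp add: lex_product_def card_cartesian_product)

lemma super_domination_number_lex_product_left:
  assumes G: "pair_graph G" and H: "pair_graph H" and h: "h \<in> pverts H"
  shows "super_domination_number (lex_product G H) + card (pverts G)
    \<le> card (pverts G) * card (pverts H) + super_domination_number G"
proof -
  interpret H: pair_graph H by (rule H)
  have "(h, h) \<notin> parcs H" using H.pair_no_loops by fastforce
  then have "super_domination_number (lex_product G H) + card (pverts G)
      \<le> card (pverts (lex_product G H)) + super_domination_number G"
    using h
    by (intro super_domination_number_induced_subgraph[where f = "\<lambda>g. (g, h)"]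
        G pair_graph_lex_product[OF G H])
      (auto simp: lex_product_def inj_on_def)
  then show ?thesis by (simp add: card_pverts_lex_product)
qed

lemma super_domination_number_lex_product_right:
  assumes G: "pair_graph G" and H: "pair_graph H" and g: "g \<in> pverts G"
  shows "super_domination_number (lex_product G H) + card (pverts H)
    \<le> card (pverts G) * card (pverts H) + super_domination_number H"
proof -
  interpret G: pair_graph G by (rule G)
  have "(g, g) \<notin> parcs G" using G.pair_no_loops by fastforce
  then have "super_domination_number (lex_product G H) + card (pverts H)
      \<le> card (pverts (lex_product G H)) + super_domination_number H"
    using g
    by (intro super_domination_number_induced_subgraph[where f = "\<lambda>h. (g, h)"]
        H pair_graph_lex_product[OF G H])
      (auto simp: lex_product_def inj_on_def)
  then show ?thesis by (simp add: card_pverts_lex_product)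
qed

theorem theorem12:
  fixes G :: "'a pair_pre_digraph" and H :: "'b pair_pre_digraph" and n n' :: nat
  assumes "pair_graph G" and "card (pverts G) = n" and "n \<ge> 2"
    and "pair_graph H" and "card (pverts H) = n'" and "n' \<ge> 2"
  shows "super_domination_number (lex_product G H)
    \<le> min (n * (n' - 1) + super_domination_number G)
          (n' * (n - 1) + super_domination_number H)"
proof -
  have "pverts G \<noteq> {}" and "pverts H \<noteq> {}"
    using assms by auto
  then obtain g h where "g \<in> pverts G" and "h \<in> pverts H" by blast
  then have left: "super_domination_number (lex_product G H) + n
        \<le> n * n' + super_domination_number G"
    and right: "super_domination_number (lex_product G H) + n'
        \<le> n * n' + super_domination_number H"
    using super_domination_number_lex_product_left[OF assms(1,4)]
      super_domination_number_lex_product_right[OF assms(1,4)] assms(2,5) by auto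
  have "n * n' = n * (n' - 1) + n" and "n * n' = n' * (n - 1) + n'"
    using assms(3,6) by (simp_all add: algebra_simps)
  with left right show ?thesis by linarith
qed

end
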